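(* Let $f_1,\dots,f_n:\mathbb{R}^p\to\mathbb{R}$ be twice differentiable and $F(\mathbf{x})=\frac1n\sum_{i=1}^n f_i(\mathbf{x})$. Assume that there are constants $0<K_i<\infty$ with $0\preceq\nabla^2 f_i(\mathbf{x})\preceq K_i\mathbb{I}$ for all $\mathbf{x}\in\mathbb{R}^p$ and $i=1,\dots,n$, and let $0<K<\infty$ be a constant with $\nabla^2F(\mathbf{x})\preceq K\mathbb{I}$ for all $\mathbf{x}\in\mathbb{R}^p$. Let $0<\theta_2<1$, $0<\beta<1$, $\widehat\alpha\ge1$ be given. For any $\mathbf{x}^{(k)}\in\mathbb{R}^p$, let $\mathbf{x}^{(k+1)}$ be obtained from $\mathbf{x}^{(k)}$ by one iteration of the spectrally regularized sub-sampled Newton algorithm described in the context, with arbitrary sample size $|\mathcal{S}|\ge1$, sampling without replacement, and inexact update with tolerances $\theta_1^{(k)},\theta_2$. If $$\theta_1^{(k)}\le\frac12\sqrt{\frac{\lambda^{(k)}}{\max\{\lambda^{(k)},\widehat K_{|\mathcal{S}|}\}}},$$ then $$F(\mathbf{x}^{(k+1)})\le F(\mathbf{x}^{(k)})-\frac{\alpha_k\beta}{2\max\{\widehat K_{|\mathcal{S}|},\lambda^{(k)}\}}\|\nabla F(\mathbf{x}^{(k)})\|^2.$$ If, in addition, there is a constant $0<\gamma\le K$ with $\gamma\mathbb{I}\preceq\nabla^2F(\mathbf{x})$ for all $\mathbf{x}\in\mathbb{R}^p$, then, with $\mathbf{x}^*$ the minimizer of $F$, $$F(\mathbf{x}^{(k+1)})-F(\mathbf{x}^*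 )\le(1-\rho)\big(F(\mathbf{x}^{(k)})-F(\mathbf{x}^* )\big),\qquad\rho=\frac{\alpha_k\beta\gamma}{\max\{\widehat K_{|\mathcal{S}|},\lambda^{(k)}\}}.$$ Moreover, in both cases, the step size is at least $$\alpha_k\ge\frac{2(1-\theta_2)(1-\beta)\lambda^{(k)}}{K}.$$
   Context: For an integer $1\le q\le n$, $\widehat K_q$ is the average of the $q$ largest values among $K_1,\dots,K_n$. Spectral regularization: for $\lambda\ge0$ and a symmetric matrix $H\in\mathbb{R}^{p\times p}$ with orthonormal eigenvectors $\mathbf{v}_i$ and eigenvalues $\lambda_i(H)$, $\mathcal{P}(\lambda;H)=\sum_{i=1}^p\max\{\lambda_i(H),\lambda\}\mathbf{v}_i\mathbf{v}_i^T$ (equivalently $\lambda\mathbb{I}+\arg\min_{X\succeq0}\|H-\lambda\mathbb{I}-X\|_F$). Algorithm (one iteration). A collection $\mathcal{S}$ of $|\mathcal{S}|\ge1$ indices is drawn from $\{1,\dots,n\}$ uniformly at random without replacement, and $H(\mathbf{x}^{(k)})=\frac1{|\mathcal{S}|}\sum_{j\in\mathcal{S}}\nabla^2f_j(\mathbf{x}^{(k)})$. Choose any $\lambda^{(k)}>\lambda_{\min}(H(\mathbf{x}^{(k)}))$ and set $\hat H(\mathbf{x}^{(k)})=\mathcal{P}(\lambda^{(k)};H(\mathbf{x}^{(k)}))$. Then $\mathbf{x}^{(k+1)}=\mathbf{x}^{(k)}+\alpha_k\mathbf{p}_k$, where, for a tolerance $\theta_1^{(k)}\ge0$, $\mathbf{p}_k$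 is any vector satisfying both $$\|\hat H(\mathbf{x}^{(k)})\mathbf{p}_k+\nabla F(\mathbf{x}^{(k)})\|\le\theta_1^{(k)}\|\nabla F(\mathbf{x}^{(k)})\|,\qquad \mathbf{p}_k^T\nabla F(\mathbf{x}^{(k)})\le-(1-\theta_2)\,\mathbf{p}_k^T\hat H(\mathbf{x}^{(k)})\mathbf{p}_k,$$ and $\alpha_k$ is the largest $\alpha\le\widehat\alpha$ such that $F(\mathbf{x}^{(k)}+\alpha\mathbf{p}_k)\le F(\mathbf{x}^{(k)})+\alpha\beta\,\mathbf{p}_k^T\nabla F(\mathbf{x}^{(k)})$. $A\preceq B$ means $B-A$ is symmetric positive semi-definite.
   Formalization: The step-size bound is proved as α_k ≥ min{α̂, 2(1−θ₂)(1−β)λ^(k)/K}, since α_k ≤ α̂ by construction and the bound as printed fails whenever 2(1−θ₂)(1−β)λ^(k)/K exceeds α̂. *)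

theory Defs
  imports "HOL-Analysis.Analysis"
begin

definition grad :: "(real^'p \<Rightarrow> real) \<Rightarrow> real^'p \<Rightarrow> real^'p" where
  "grad f x = (THE D. GDERIV f x :> D)"

definition hessian :: "(real^'p \<Rightarrow> real) \<Rightarrow> real^'p \<Rightarrow> real^'p^'p" where
  "hessian f x = jacobian (grad f) (at x)"

definition twice_differentiable :: "(real^'p \<Rightarrow> real) \<Rightarrow> bool" where
  "twice_differentiable f \<longleftrightarrow>
     (\<forall>x. f differentiable (at x)) \<and> (\<forall>x. grad f differentiable (at x))"

definition sym_psd :: "real^'p^'p \<Rightarrow> bool" where
  "sym_psd A \<longleftrightarrow> transpose A = A \<and> (\<forall>v. 0 \<le> v \<bullet> (A *v v))"

definition loewner_le :: "real^'p^'p \<Rightarrow> real^'p^'p \<Rightarrow> bool" (infix \<open>\<preceq>\<^sub>L\<close> 50) where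
  "A \<preceq>\<^sub>L B \<longleftrightarrow> sym_psd (B - A)"

definition average_fun :: "nat \<Rightarrow> (nat \<Rightarrow> real^'p \<Rightarrow> real) \<Rightarrow> real^'p \<Rightarrow> real" where
  "average_fun n f x = (1 / real n) * (\<Sum>i=1..n. f i x)"

definition K_hat :: "nat \<Rightarrow> (nat \<Rightarrow> real) \<Rightarrow> nat \<Rightarrow> real" where
  "K_hat n Ks q = sum_list (take q (rev (sort (map Ks [1..<Suc n])))) / real q"

definition sampled_hessian ::
  "(nat \<Rightarrow> real^'p \<Rightarrow> real) \<Rightarrow> nat set \<Rightarrow> real^'p \<Rightarrow> real^'p^'p" where
  "sampled_hessian f S x = (1 / real (card S)) *\<^sub>R (\<Sum>j\<in>S. hessian (f j) x)"

definition eigenvalues :: "real^'p^'p \<Rightarrow> real set" where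
  "eigenvalues H = {\<mu>. \<exists>v. v \<noteq> 0 \<and> H *v v = \<mu> *\<^sub>R v}"

definition lambda_min :: "real^'p^'p \<Rightarrow> real" where
  "lambda_min H = Min (eigenvalues H)"

definition orthonormal_eigensystem ::
  "real^'p^'p \<Rightarrow> ('p \<Rightarrow> real^'p) \<Rightarrow> ('p \<Rightarrow> real) \<Rightarrow> bool" where
  "orthonormal_eigensystem H v l \<longleftrightarrow>
     (\<forall>i j. v i \<bullet> v j = (if i = j then 1 else 0)) \<and> (\<forall>i. H *v v i = l i *\<^sub>R v i)"

definition outer :: "real^'p \<Rightarrow> real^'p \<Rightarrow> real^'p^'p" where
  "outer v w = (\<chi> a b. v $ a * w $ b)"

text \<open>The spectral regularization is a relation so that no particular eigenbasis of \<open>H\<close> has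
  to be selected. For symmetric \<open>H\<close> an orthonormal eigensystem exists and the resulting
  matrix does not depend on it, so the relation is then the graph of a function of \<open>H\<close>.\<close>

definition spectral_regularization :: "real \<Rightarrow> real^'p^'p \<Rightarrow> real^'p^'p \<Rightarrow> bool" where
  "spectral_regularization lam H Hhat \<longleftrightarrow>
     (\<exists>v l. orthonormal_eigensystem H v l \<and>
            Hhat = (\<Sum>i\<in>UNIV. max (l i) lam *\<^sub>R outer (v i) (v i)))"

definition armijo ::
  "(real^'p \<Rightarrow> real) \<Rightarrow> real \<Rightarrow> real^'p \<Rightarrow> real^'p \<Rightarrow> real \<Rightarrow> bool" where
  "armijo F \<beta> x p \<alpha> \<longleftrightarrow> F (x + \<alpha> *\<^sub>R p) \<le> F x + \<alpha> * \<beta> * (p \<bullet> grad F x)"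

definition line_search_step ::
  "(real^'p \<Rightarrow> real) \<Rightarrow> real \<Rightarrow> real \<Rightarrow> real^'p \<Rightarrow> real^'p \<Rightarrow> real \<Rightarrow> bool" where
  "line_search_step F \<beta> \<alpha>hat x p \<alpha> \<longleftrightarrow>
     \<alpha> \<le> \<alpha>hat \<and> armijo F \<beta> x p \<alpha> \<and> (\<forall>a. a \<le> \<alpha>hat \<and> armijo F \<beta> x p a \<longrightarrow> a \<le> \<alpha>)"

text \<open>\<open>S\<close> is the realized sample. Sampling without replacement makes it a subset of the index
  set, and every nonempty subset is a possible outcome.\<close>

definition newton_iteration ::
  "nat \<Rightarrow> (nat \<Rightarrow> real^'p \<Rightarrow> real) \<Rightarrow> nat set \<Rightarrow> real \<Rightarrow> real \<Rightarrow> real \<Rightarrow> real \<Rightarrow> real \<Rightarrow>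
   real^'p \<Rightarrow> real^'p \<Rightarrow> real \<Rightarrow> real^'p \<Rightarrow> bool" where
  "newton_iteration n f S lam \<theta>\<^sub>1 \<theta>\<^sub>2 \<beta> \<alpha>hat x p \<alpha> x' \<longleftrightarrow>
     (let F = average_fun n f; H = sampled_hessian f S x in
        S \<subseteq> {1..n} \<and> 1 \<le> card S \<and>
        lam > lambda_min H \<and> 0 \<le> \<theta>\<^sub>1 \<and>
        (\<exists>Hhat. spectral_regularization lam H Hhat \<and>
           norm (Hhat *v p + grad F x) \<le> \<theta>\<^sub>1 * norm (grad F x) \<and>
           p \<bullet> grad F x \<le> - (1 - \<theta>\<^sub>2) * (p \<bullet> (Hhat *v p))) \<and>
        line_search_step F \<beta> \<alpha>hat x p \<alpha> \<and>
        x' = x + \<alpha> *\<^sub>R p)"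

end

theory Submission
  imports Defs
begin

text \<open>Write \<open>M\<close> for the maximum of \<open>K_hat\<close> and \<open>lam\<close>, and \<open>g\<close> for the gradient at \<open>x\<close>.
  The regularized matrix has spectrum in
  \<open>[lam, M]\<close>, so in an orthonormal eigenbasis the residual bound and weighted AM-GM give
  \<open>p \<bullet> g \<le> - |g|\<^sup>2 / (2 M)\<close>, and the Armijo condition turns this into the decrease of \<open>F\<close>.
  Strong convexity bounds \<open>F x - F xstar\<close> by \<open>|g|\<^sup>2 / (2 \<gamma>)\<close>, which yields the linear rate. By
  the second-order Taylor formula, the curvature bound \<open>p \<bullet> Hhat p \<ge> lam |p|\<^sup>2\<close> makes every
  small enough step satisfy the Armijo condition.\<close>

section \<open>Gradients and second-order expansion\<close>

lemma GDERIV_unique: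
  assumes "GDERIV f x :> D" "GDERIV f x :> E"
  shows "D = E"
proof -
  have "(\<lambda>h. h \<bullet> D) = (\<lambda>h. h \<bullet> E)"
    using assms unfolding gderiv_def by (rule has_derivative_unique)
  then show ?thesis
    by (metis vector_eq_ldot)
qed

lemma grad_eqI: "GDERIV f x :> D \<Longrightarrow> grad f x = D"
  unfolding grad_def using GDERIV_unique by blast

text \<open>The derivative is a linear functional \<open>f'\<close>, and the defining property of
  the adjoint represents it as the inner product with \<open>adjoint f' 1\<close>. Together with
  uniqueness this gives the definite description in \<open>grad\<close> its value.\<close>

lemma GDERIV_grad:
  assumes "f differentiable (at x)"
  shows "GDERIV f x :> grad f x"
proof -
  obtain f' where f': "(f has_derivative f') (at x)"
    using assms unfolding differentiable_def by blast
  have "f' = (\<lambda>h. h \<bullet> adjoint f' 1)"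
    using adjoint_works[OF has_derivative_linear[OF f'], of _ 1] by auto
  with f' have "GDERIV f x :> adjoint f' 1"
    unfolding gderiv_def by simp
  then show ?thesis
    using grad_eqI by metis
qed

text \<open>The gradient of the average is computed at every point first. This yields an equation
  between functions, which lets \<open>grad\<close> of the average inherit differentiability from
  the summands.\<close>

lemma twice_differentiable_average_fun:
  assumes "\<And>i. i \<in> {1..n} \<Longrightarrow> twice_differentiable (f i)"
  shows "twice_differentiable (average_fun n f)"
proof -
  have der: "GDERIV (average_fun n f) x :> (1 / real n) *\<^sub>R (\<Sum>i=1..n. grad (f i) x)" for x
  proof -
    have "((\<lambda>y. (1 / real n) * (\<Sum>i=1..n. f i y)) has_derivative
        (\<lambda>h. (1 / real n) * (\<Sum>i=1..n. h \<bullet> grad (f i) x))) (at x)"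
      using assms GDERIV_grad unfolding twice_differentiable_def gderiv_def
      by (intro has_derivative_mult_right has_derivative_sum) blast
    then show ?thesis
      unfolding gderiv_def average_fun_def[abs_def] by (simp add: inner_sum_right)
  qed
  have grad: "grad (average_fun n f) = (\<lambda>x. (1 / real n) *\<^sub>R (\<Sum>i=1..n. grad (f i) x))"
    using grad_eqI[OF der] by blast
  have "average_fun n f differentiable (at x)" for x
    using der unfolding gderiv_def differentiable_def by blast
  moreover have "grad (average_fun n f) differentiable (at x)" for x
    unfolding grad using assms
    by (intro differentiable_scaleR differentiable_sum differentiable_const)
      (simp_all add: twice_differentiable_def)
  ultimately show ?thesis
    unfolding twice_differentiable_def by blast
qed

text \<open>Restriction to the segment from \<open>x\<close> to \<open>x + d\<close> reduces this to
  one variable. The Lagrange remainder asks only that the second derivative exist, which matches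
  \<open>twice_differentiable\<close>; a Hessian bound valid at all points then applies at the
  unknown \<open>z\<close>.\<close>

lemma taylor_second_order:
  assumes "twice_differentiable F"
  obtains z where "F (x + d) = F x + d \<bullet> grad F x + (d \<bullet> (hessian F z *v d)) / 2"
proof -
  \<comment> \<open>For \<open>m \<le> 2\<close> this is the \<open>m\<close>-th derivative of
    \<open>F\<close> along the segment. Values for \<open>m > 2\<close> are filler, since the
    expansion stops at order 2.\<close>
  define diff where "diff = (\<lambda>m::nat. \<lambda>t::real.
    if m = 0 then F (x + t *\<^sub>R d)
    else if m = 1 then d \<bullet> grad F (x + t *\<^sub>R d)
    else d \<bullet> (hessian F (x + t *\<^sub>R d) *v d))"
  have line: "((\<lambda>t. x + t *\<^sub>R d) has_derivative (\<lambda>s. s *\<^sub>R d)) (at t)" for t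
    by (auto intro!: derivative_eq_intros)
  have "DERIV (diff 0) t :> diff 1 t" for t
  proof -
    have "(F has_derivative (\<lambda>h. h \<bullet> grad F (x + t *\<^sub>R d))) (at (x + t *\<^sub>R d))"
      using assms GDERIV_grad unfolding twice_differentiable_def gderiv_def by blast
    from has_derivative_compose[OF line this] show ?thesis
      by (simp add: diff_def has_field_derivative_def mult_commute_abs)
  qed
  moreover have "DERIV (diff 1) t :> diff 2 t" for t
  proof -
    have "(grad F has_derivative (\<lambda>h. hessian F (x + t *\<^sub>R d) *v h)) (at (x + t *\<^sub>R d))"
      using assms unfolding twice_differentiable_def hessian_def jacobian_works by blast
    from has_derivative_inner_right[OF has_derivative_compose[OF line this], of d]
    show ?thesis
      by (simp add: diff_def has_field_derivative_def matrix_vector_mult_scaleR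
          mult_commute_abs)
  qed
  ultimately have "\<forall>m t. m < 2 \<and> 0 \<le> t \<and> t \<le> 1 \<longrightarrow> DERIV (diff m) t :> diff (Suc m) t"
    by (auto simp: less_2_cases_iff simp flip: numeral_2_eq_2)
  from Maclaurin[of 1 2 diff "diff 0", OF _ _ _ this]
  obtain t where "diff 0 1 = (\<Sum>m<2. diff m 0 / fact m * 1 ^ m) + diff 2 t / fact 2 * 1 ^ 2"
    by auto
  then show thesis
    by (intro that[of "x + t *\<^sub>R d"]) (simp add: diff_def numeral_2_eq_2)
qed

lemma loewner_le_inner:
  assumes "A \<preceq>\<^sub>L B"
  shows "v \<bullet> (A *v v) \<le> v \<bullet> (B *v v)"
  using assms unfolding loewner_le_def sym_psd_def
  by (simp add: matrix_vector_mult_diff_rdistrib inner_diff_right)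

lemma mat_mult_vec: "mat c *v v = c *\<^sub>R (v :: real^'n)"
  by (simp add: vec_eq_iff matrix_vector_mult_def mat_def if_distrib[of "\<lambda>t. t * _"] cong: if_cong)

lemma upper_quadratic_bound:
  assumes "twice_differentiable F" "\<And>y. hessian F y \<preceq>\<^sub>L mat K"
  shows "F (x + d) \<le> F x + d \<bullet> grad F x + K / 2 * (d \<bullet> d)"
proof -
  obtain z where z: "F (x + d) = F x + d \<bullet> grad F x + (d \<bullet> (hessian F z *v d)) / 2"
    using taylor_second_order[OF assms(1)] .
  show ?thesis
    using loewner_le_inner[OF assms(2)[of z], of d] by (simp add: z mat_mult_vec)
qed

lemma lower_quadratic_bound:
  assumes "twice_differentiable F" "\<And>y. mat c \<preceq>\<^sub>L hessian F y"
  shows "F x + d \<bullet> grad F x + c / 2 * (d \<bullet> d) \<le> F (x + d)"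
proof -
  obtain z where z: "F (x + d) = F x + d \<bullet> grad F x + (d \<bullet> (hessian F z *v d)) / 2"
    using taylor_second_order[OF assms(1)] .
  show ?thesis
    using loewner_le_inner[OF assms(2)[of z], of d] by (simp add: z mat_mult_vec)
qed

text \<open>The lower quadratic model of \<open>F\<close> around \<open>x\<close> is smallest at the
  displacement \<open>- g / c\<close>, where it falls below \<open>F x\<close> by
  \<open>|g|^2 / (2 c)\<close>. Expanding the square of \<open>c d + g\<close> proves this without
  an explicit minimization.\<close>

lemma polyak_lojasiewicz:
  assumes "twice_differentiable F" "\<And>y. mat c \<preceq>\<^sub>L hessian F y" "0 < c"
  shows "2 * c * (F x - F y) \<le> (norm (grad F x))\<^sup>2"
proof -
  define d where "d = y - x"
  define g where "g = grad F x"
  have "0 \<le> (c *\<^sub>R d + g) \<bullet> (c *\<^sub>R d + g)"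
    by (rule inner_ge_zero)
  also have "\<dots> = c * (c * (d \<bullet> d)) + 2 * (c * (d \<bullet> g)) + g \<bullet> g"
    by (simp add: inner_add_left inner_add_right inner_commute)
  also have "\<dots> = 2 * c * (d \<bullet> g + c / 2 * (d \<bullet> d)) + g \<bullet> g"
    by (simp add: algebra_simps)
  also have "\<dots> \<le> 2 * c * (F y - F x) + g \<bullet> g"
    using lower_quadratic_bound[OF assms(1,2), of x d] \<open>0 < c\<close>
    by (intro add_right_mono mult_left_mono) (simp_all add: d_def g_def)
  finally show ?thesis
    by (simp add: g_def power2_norm_eq_inner algebra_simps)
qed

section \<open>Orthonormal eigensystems\<close>

text \<open>Parseval's identity. The family is indexed by the coordinate type, so the matrix
  \<open>V\<close> with rows \<open>v i\<close> is square, and its right inverse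
  \<open>transpose V\<close> is also a left inverse.\<close>

lemma inner_orthonormal_expansion:
  fixes v :: "'p::finite \<Rightarrow> real^'p"
  assumes "\<And>i j. v i \<bullet> v j = (if i = j then 1 else 0)"
  shows "x \<bullet> y = (\<Sum>i\<in>UNIV. (v i \<bullet> x) * (v i \<bullet> y))"
proof -
  define V where "V = (\<chi> i. v i)"
  have "V ** transpose V = mat 1"
    using assms by (simp add: V_def vec_eq_iff matrix_matrix_mult_def transpose_def mat_def inner_vec_def)
  then have V: "transpose V ** V = mat 1"
    by (simp add: matrix_left_right_inverse)
  have "x \<bullet> y = x \<bullet> (transpose V *v (V *v y))"
    by (simp add: matrix_vector_mul_assoc V)
  also have "\<dots> = (V *v x) \<bullet> (V *v y)"
    by (metis dot_lmul_matrix vector_transpose_matrix inner_commute transpose_transpose)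
  also have "\<dots> = (\<Sum>i\<in>UNIV. (v i \<bullet> x) * (v i \<bullet> y))"
    by (simp add: V_def inner_vec_def matrix_vector_mult_def)
  finally show ?thesis .
qed

lemma symmetric_matrix_inner:
  fixes A :: "real^'n^'n"
  assumes "transpose A = A"
  shows "x \<bullet> (A *v y) = (A *v x) \<bullet> y"
  by (metis assms dot_lmul_matrix transpose_matrix_vector)

text \<open>By Parseval a nonzero eigenvector \<open>w\<close> has a nonzero coordinate along some
  \<open>v i\<close>; moving \<open>H\<close> across the inner product
  \<open>v i \<bullet> (H *v w)\<close> then forces its eigenvalue to be \<open>l i\<close>. The
  minimum in \<open>lambda_min\<close> thus runs over the finite set \<open>range l\<close>.\<close>

lemma eigenvalues_eq_range:
  assumes es: "orthonormal_eigensystem H v l" and "transpose H = H"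
  shows "eigenvalues H = range l"
proof (intro equalityI subsetI)
  have on: "\<And>i j. v i \<bullet> v j = (if i = j then 1 else 0)" and ev: "\<And>i. H *v v i = l i *\<^sub>R v i"
    using es unfolding orthonormal_eigensystem_def by auto
  {
    fix \<mu> assume "\<mu> \<in> eigenvalues H"
    then obtain w where w: "w \<noteq> 0" "H *v w = \<mu> *\<^sub>R w"
      unfolding eigenvalues_def by blast
    have "(\<Sum>i\<in>UNIV. (v i \<bullet> w) * (v i \<bullet> w)) \<noteq> 0"
      using w(1) unfolding inner_orthonormal_expansion[OF on, symmetric] by simp
    then obtain i where "(v i \<bullet> w) * (v i \<bullet> w) \<noteq> 0"
      by (rule sum.not_neutral_contains_not_neutral)
    then have i: "v i \<bullet> w \<noteq> 0"
      by simp
    have "l i * (v i \<bullet> w) = \<mu> * (v i \<bullet> w)"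
      using symmetric_matrix_inner[OF assms(2), of "v i" w] by (auto simp: w ev)
    with i show "\<mu> \<in> range l"
      by auto
  next
    fix \<mu> assume "\<mu> \<in> range l"
    moreover have "v i \<noteq> 0" for i
      using on[of i i] by auto
    ultimately show "\<mu> \<in> eigenvalues H"
      using ev unfolding eigenvalues_def by blast
  }
qed

lemma lambda_min_eq_Min:
  assumes "orthonormal_eigensystem H v l" "transpose H = H"
  shows "lambda_min H = Min (range l)"
  using eigenvalues_eq_range[OF assms] by (simp add: lambda_min_def)

lemma outer_mult_vec: "outer v w *v x = (w \<bullet> x) *\<^sub>R v"
  by (simp add: vec_eq_iff outer_def matrix_vector_mult_def inner_vec_def sum_distrib_left
      sum_distrib_right mult_ac)

lemma sum_matrix_mult_vec: "(\<Sum>i\<in>I. A i) *v x = (\<Sum>i\<in>I. A i *v (x :: real^'n))"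
  by (induction I rule: infinite_finite_induct)
    (simp_all add: matrix_vector_mult_add_rdistrib)

lemma inner_eigenvector_spectral_sum:
  fixes v :: "'p::finite \<Rightarrow> real^'n"
  assumes "\<And>i j. v i \<bullet> v j = (if i = j then 1 else 0)"
  shows "v i \<bullet> ((\<Sum>j\<in>UNIV. m j *\<^sub>R outer (v j) (v j)) *v x) = m i * (v i \<bullet> x)"
  by (simp add: sum_matrix_mult_vec scaleR_matrix_vector_assoc[symmetric] outer_mult_vec
      inner_sum_right assms if_distrib cong: if_cong)

text \<open>With residual \<open>r\<close>, the coordinates of \<open>p\<close> are
  \<open>(r_i - g_i) / m_i\<close>. The tolerance keeps the cost of the residual below
  \<open>|g|^2 / (4 M)\<close>, while the gradient terms contribute at least
  \<open>3/4 |g|^2 / M\<close>; the difference is the claimed half.\<close>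

lemma inexact_newton_direction:
  fixes v :: "'p::finite \<Rightarrow> real^'p" and g p :: "real^'p"
  assumes on: "\<And>i j. v i \<bullet> v j = (if i = j then 1 else 0)"
    and A: "\<And>i x. v i \<bullet> (A *v x) = m i * (v i \<bullet> x)"
    and m: "\<And>i. lam \<le> m i" "\<And>i. m i \<le> M" and "0 < lam"
    and res: "norm (A *v p + g) \<le> \<theta> * norm g" and "0 \<le> \<theta>" "\<theta> \<le> 1 / 2 * sqrt (lam / M)"
  shows "p \<bullet> g \<le> - (norm g)\<^sup>2 / (2 * M)"
proof -
  note expand = inner_orthonormal_expansion[OF on]
  define r where "r = A *v p + g"
  define S where "S = (\<Sum>i\<in>UNIV. (v i \<bullet> g)\<^sup>2 / m i)"
  have mpos: "0 < m i" for i
    using m(1) \<open>0 < lam\<close> by (rule less_le_trans[rotated])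
  then have "0 < M"
    using m(2) less_le_trans by blast
  have "\<theta>\<^sup>2 \<le> (1 / 2 * sqrt (lam / M))\<^sup>2"
    using assms by (intro power_mono)
  then have \<theta>: "\<theta>\<^sup>2 \<le> lam / (4 * M)"
    using \<open>0 < lam\<close> \<open>0 < M\<close> by (simp add: power_mult_distrib power2_eq_square)
  have "(norm r)\<^sup>2 \<le> (\<theta> * norm g)\<^sup>2"
    using res unfolding r_def by (intro power_mono) auto
  also have "\<dots> \<le> lam / (4 * M) * (norm g)\<^sup>2"
    unfolding power_mult_distrib by (intro mult_right_mono \<theta>) simp
  finally have r: "(norm r)\<^sup>2 / lam \<le> 1 / 4 * ((norm g)\<^sup>2 / M)"
    using \<open>0 < lam\<close> by (simp add: field_simps)
  have norm_expand: "(norm y)\<^sup>2 = (\<Sum>i\<in>UNIV. (v i \<bullet> y)\<^sup>2)" for y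
    using expand[of y y] unfolding power2_norm_eq_inner by (simp add: power2_eq_square)
  have S: "(norm g)\<^sup>2 / M \<le> S"
    unfolding S_def norm_expand sum_divide_distrib
    using m(2) mpos by (intro sum_mono divide_left_mono) (auto simp: \<open>0 < M\<close>)
  have "p \<bullet> g = (\<Sum>i\<in>UNIV. (v i \<bullet> p) * (v i \<bullet> g))"
    by (rule expand)
  \<comment> \<open>The weighted AM-GM inequality \<open>a b \<le> a^2 + b^2 / 4\<close> leaves
    \<open>3/4\<close> of the gradient term. Only the residual term has its denominator weakened
    from \<open>m i\<close> to \<open>lam\<close>, to match the bound on
    \<open>|r|^2 / lam\<close>.\<close>
  also have "\<dots> \<le> (\<Sum>i\<in>UNIV. (v i \<bullet> r)\<^sup>2 / lam - 3 / 4 * ((v i \<bullet> g)\<^sup>2 / m i))"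
  proof (rule sum_mono)
    fix i
    define a where "a = v i \<bullet> r"
    define b where "b = v i \<bullet> g"
    have "a = m i * (v i \<bullet> p) + b"
      by (simp add: a_def b_def r_def inner_add_right A)
    then have "v i \<bullet> p = (a - b) / m i"
      using mpos[of i] by (simp add: field_simps)
    then have "(v i \<bullet> p) * b = (a * b - b\<^sup>2) / m i"
      by (simp add: power2_eq_square algebra_simps)
    also have "\<dots> \<le> (a\<^sup>2 - 3 / 4 * b\<^sup>2) / m i"
    proof (rule divide_right_mono)
      have "0 \<le> (a - b / 2)\<^sup>2"
        by simp
      then show "a * b - b\<^sup>2 \<le> a\<^sup>2 - 3 / 4 * b\<^sup>2"
        by (simp add: power2_eq_square algebra_simps)
    qed (use mpos[of i] in simp)
    also have "\<dots> = a\<^sup>2 / m i - 3 / 4 * (b\<^sup>2 / m i)"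
      by (simp add: diff_divide_distrib)
    also have "a\<^sup>2 / m i \<le> a\<^sup>2 / lam"
      using m(1)[of i] mpos[of i] \<open>0 < lam\<close> by (intro divide_left_mono) auto
    finally show "(v i \<bullet> p) * (v i \<bullet> g) \<le> (v i \<bullet> r)\<^sup>2 / lam - 3 / 4 * ((v i \<bullet> g)\<^sup>2 / m i)"
      by (simp add: a_def b_def)
  qed
  also have "\<dots> = (norm r)\<^sup>2 / lam - 3 / 4 * S"
    unfolding S_def norm_expand by (simp add: sum_subtractf sum_divide_distrib sum_distrib_left)
  also have "\<dots> \<le> - (1 / 2 * ((norm g)\<^sup>2 / M))"
    using r S by argo
  finally show ?thesis
    by simp
qed

section \<open>The sampled Hessian\<close>

text \<open>Subtracting the \<open>q\<close>-th largest value \<open>t\<close> leaves only the \<open>q\<close> largest entries with a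
  positive part, so the positive parts over any index set are bounded by their sum.\<close>

lemma sum_le_sum_list_largest:
  fixes k :: "nat \<Rightarrow> real"
  assumes "S \<subseteq> {1..n}"
  shows "(\<Sum>i\<in>S. k i) \<le> sum_list (take (card S) (rev (sort (map k [1..<Suc n]))))"
proof (cases "S = {}")
  case False
  define ys where "ys = rev (sort (map k [1..<Suc n]))"
  define q where "q = card S"
  \<comment> \<open>Lists are indexed from 0, so in the decreasing list \<open>ys\<close> this is
    the \<open>q\<close>-th largest entry; the index is legitimate because \<open>S\<close> is
    nonempty here.\<close>
  define t where "t = ys ! (q - 1)"
  define h where "h = (\<lambda>a. max (a - t) 0)"
  have fin: "finite S"
    using assms finite_subset by blast
  then have "0 < q"
    using False by (simp add: q_def card_gt_0_iff)
  have len: "length ys = n"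
    by (simp add: ys_def)
  have "q \<le> n"
    using card_mono[OF _ assms] by (simp add: q_def)
  have desc: "sorted_wrt (\<ge>) ys"
    unfolding ys_def by (simp add: sorted_wrt_rev)
  have ge: "t \<le> a" if a: "a \<in> set (take q ys)" for a
  proof -
    obtain i where i: "i < q" "a = ys ! i"
      using a len \<open>q \<le> n\<close> by (auto simp: in_set_conv_nth)
    then show ?thesis
      using sorted_wrt_nth_less[OF desc, of i "q - 1"] len \<open>q \<le> n\<close>
      by (cases "i = q - 1") (auto simp: t_def)
  qed
  have le: "a \<le> t" if a: "a \<in> set (drop q ys)" for a
  proof -
    obtain i where "i < length (drop q ys)" "a = drop q ys ! i"
      using a by (metis in_set_conv_nth)
    then have i: "q + i < n" "a = ys ! (q + i)"
      using len by auto
    show ?thesis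
      using i sorted_wrt_nth_less[OF desc, of "q - 1" "q + i"] len \<open>0 < q\<close>
      by (auto simp: t_def)
  qed
  \<comment> \<open>Both \<open>S\<close> and the prefix \<open>take q ys\<close> have
    \<open>q\<close> elements, so the shift by \<open>t\<close> cancels at the end.\<close>
  have "(\<Sum>i\<in>S. k i) = (\<Sum>i\<in>S. k i - t) + real q * t"
    by (simp add: sum_subtractf q_def)
  also have "(\<Sum>i\<in>S. k i - t) \<le> (\<Sum>i\<in>S. h (k i))"
    by (intro sum_mono) (simp add: h_def)
  also have "\<dots> \<le> (\<Sum>i\<in>{1..n}. h (k i))"
    using assms by (intro sum_mono2) (auto simp: h_def)
  also have "\<dots> = sum_list (map h (map k [1..<Suc n]))"
    by (simp add: sum_list_distinct_conv_sum_set atLeastLessThanSuc_atLeastAtMost o_def del: upt_Suc)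
  \<comment> \<open>Sorting and reversing preserve the multiset of entries, hence the sum.\<close>
  also have "\<dots> = sum_list (map h ys)"
    unfolding sum_mset_sum_list[symmetric] mset_map by (simp add: ys_def del: upt_Suc)
  also have "\<dots> = sum_list (map h (take q ys)) + sum_list (map h (drop q ys))"
    by (metis append_take_drop_id map_append sum_list_append)
  also have "map h (drop q ys) = map (\<lambda>_. 0) (drop q ys)"
    using le by (intro map_cong) (auto simp: h_def)
  also have "map h (take q ys) = map (\<lambda>a. a - t) (take q ys)"
    using ge by (intro map_cong) (auto simp: h_def)
  also have "sum_list (map (\<lambda>a. a - t) (take q ys)) = sum_list (take q ys) - real q * t"
    using len \<open>q \<le> n\<close> by (simp add: sum_list_subtractf sum_list_triv)
  finally show ?thesis
    by (simp add: ys_def q_def del: upt_Suc)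
qed simp

lemma average_le_K_hat:
  assumes "S \<subseteq> {1..n}"
  shows "1 / real (card S) * (\<Sum>i\<in>S. k i) \<le> K_hat n k (card S)"
  using divide_right_mono[OF sum_le_sum_list_largest[OF assms, of k], of "real (card S)"]
  by (simp add: K_hat_def)

lemma inner_sampled_hessian:
  "v \<bullet> (sampled_hessian f S x *v w) = 1 / real (card S) * (\<Sum>j\<in>S. v \<bullet> (hessian (f j) x *v w))"
  by (simp add: sampled_hessian_def scaleR_matrix_vector_assoc[symmetric] sum_matrix_mult_vec
      inner_sum_right)

lemma transpose_sampled_hessian:
  assumes "\<And>j. j \<in> S \<Longrightarrow> transpose (hessian (f j) x) = hessian (f j) x"
  shows "transpose (sampled_hessian f S x) = sampled_hessian f S x"
proof -
  have "hessian (f j) x $ a $ b = hessian (f j) x $ b $ a" if "j \<in> S" for j a b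
    using arg_cong[OF assms[OF that], of "\<lambda>A. A $ a $ b"] by (simp add: transpose_def)
  then show ?thesis
    by (simp add: vec_eq_iff transpose_def sampled_hessian_def)
qed

section \<open>The iteration\<close>

text \<open>The claim holds for every realized sample \<open>S\<close>. The step bound is capped at
  \<open>\<alpha>hat\<close>: \<open>lam\<close> may be any number above the smallest eigenvalue, so
  \<open>2 * (1 - \<theta>\<^sub>2) * (1 - \<beta>) * lam / K\<close> can exceed
  \<open>\<alpha>hat\<close>, whereas the line search never does.\<close>

theorem theorem4:
  fixes f :: "nat \<Rightarrow> real^'p \<Rightarrow> real" and F :: "real^'p \<Rightarrow> real"
    and Ks :: "nat \<Rightarrow> real" and n :: nat and S :: "nat set"
    and K \<theta>\<^sub>1 \<theta>\<^sub>2 \<beta> \<alpha>hat lam \<alpha> :: real and x p x' :: "real^'p"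
  defines "F \<equiv> average_fun n f"
  assumes "\<And>i. i \<in> {1..n} \<Longrightarrow> twice_differentiable (f i)"
    and "\<And>i. i \<in> {1..n} \<Longrightarrow> 0 < Ks i"
    and "\<And>i y. i \<in> {1..n} \<Longrightarrow> 0 \<preceq>\<^sub>L hessian (f i) y \<and> hessian (f i) y \<preceq>\<^sub>L mat (Ks i)"
    and "0 < K"
    and "\<And>y. hessian F y \<preceq>\<^sub>L mat K"
    and "0 < \<theta>\<^sub>2" "\<theta>\<^sub>2 < 1" "0 < \<beta>" "\<beta> < 1" "1 \<le> \<alpha>hat"
    and "newton_iteration n f S lam \<theta>\<^sub>1 \<theta>\<^sub>2 \<beta> \<alpha>hat x p \<alpha> x'"
    and "\<theta>\<^sub>1 \<le> (1 / 2) * sqrt (lam / max lam (K_hat n Ks (card S)))"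
  shows "F x' \<le> F x - \<alpha> * \<beta> / (2 * max (K_hat n Ks (card S)) lam) * (norm (grad F x))\<^sup>2
    \<and> (\<forall>\<gamma> xstar.
         0 < \<gamma> \<and> \<gamma> \<le> K \<and> (\<forall>y. mat \<gamma> \<preceq>\<^sub>L hessian F y) \<and> (\<forall>y. F xstar \<le> F y) \<longrightarrow>
         F x' - F xstar
           \<le> (1 - \<alpha> * \<beta> * \<gamma> / max (K_hat n Ks (card S)) lam) * (F x - F xstar))
    \<and> \<alpha> \<ge> min \<alpha>hat (2 * (1 - \<theta>\<^sub>2) * (1 - \<beta>) * lam / K)"
proof -
  define g where "g = grad F x"
  define H where "H = sampled_hessian f S x"
  define M where "M = max (K_hat n Ks (card S)) lam"
  have iter: "S \<subseteq> {1..n}" "1 \<le> card S" "lam > lambda_min H" "0 \<le> \<theta>\<^sub>1"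
    and ls: "line_search_step F \<beta> \<alpha>hat x p \<alpha>" and x': "x' = x + \<alpha> *\<^sub>R p"
    using assms(12) unfolding newton_iteration_def Let_def F_def H_def by auto
  obtain Hhat where Hhat: "spectral_regularization lam H Hhat"
      "norm (Hhat *v p + g) \<le> \<theta>\<^sub>1 * norm g" "p \<bullet> g \<le> - (1 - \<theta>\<^sub>2) * (p \<bullet> (Hhat *v p))"
    using assms(12) unfolding newton_iteration_def Let_def F_def H_def g_def by auto
  obtain v l where es: "orthonormal_eigensystem H v l"
      and Hhat_eq: "Hhat = (\<Sum>i\<in>UNIV. max (l i) lam *\<^sub>R outer (v i) (v i))"
    using Hhat(1) unfolding spectral_regularization_def by blast
  have on: "\<And>i j. v i \<bullet> v j = (if i = j then 1 else 0)" and ev: "\<And>i. H *v v i = l i *\<^sub>R v i"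
    using es unfolding orthonormal_eigensystem_def by auto
  have td: "twice_differentiable F"
    unfolding F_def using assms(2) by (rule twice_differentiable_average_fun)
  have hess: "transpose (hessian (f j) x) = hessian (f j) x"
      "0 \<le> w \<bullet> (hessian (f j) x *v w)" "w \<bullet> (hessian (f j) x *v w) \<le> Ks j * (w \<bullet> w)"
    if "j \<in> S" for j w
  proof -
    have j: "0 \<preceq>\<^sub>L hessian (f j) x" "hessian (f j) x \<preceq>\<^sub>L mat (Ks j)"
      using assms(4) iter(1) that by auto
    then show "transpose (hessian (f j) x) = hessian (f j) x" "0 \<le> w \<bullet> (hessian (f j) x *v w)"
      by (simp_all add: loewner_le_def sym_psd_def)
    show "w \<bullet> (hessian (f j) x *v w) \<le> Ks j * (w \<bullet> w)"
      using loewner_le_inner[OF j(2), of w] by (simp add: mat_mult_vec)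
  qed
  \<comment> \<open>As \<open>v i\<close> is a unit vector, \<open>l i\<close> is the Rayleigh
    quotient of \<open>H\<close> there, so bounds on the individual Hessians average to bounds on
    \<open>l i\<close>.\<close>
  have l_eq: "l i = 1 / real (card S) * (\<Sum>j\<in>S. v i \<bullet> (hessian (f j) x *v v i))" for i
    using inner_sampled_hessian[of "v i" f S x "v i"] by (simp add: H_def[symmetric] ev on)
  have l_nonneg: "0 \<le> l i" for i
    unfolding l_eq using hess(2) by (intro mult_nonneg_nonneg sum_nonneg) auto
  have l_le: "l i \<le> K_hat n Ks (card S)" for i
  proof -
    have "l i \<le> 1 / real (card S) * (\<Sum>j\<in>S. Ks j)"
      unfolding l_eq using hess(3)[of _ "v i"] by (intro mult_left_mono sum_mono) (auto simp: on)
    also have "\<dots> \<le> K_hat n Ks (card S)"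
      using iter(1) by (rule average_le_K_hat)
    finally show ?thesis .
  qed
  have "transpose H = H"
    unfolding H_def using hess(1) by (rule transpose_sampled_hessian)
  \<comment> \<open>Convexity of the sampled functions enters here: the smallest eigenvalue is
    nonnegative, so any \<open>lam\<close> above it is positive.\<close>
  from lambda_min_eq_Min[OF es this] have "0 \<le> lambda_min H"
    using l_nonneg by (simp add: Min_ge_iff)
  then have lam: "0 < lam"
    using iter(3) by simp
  then have M: "0 < M"
    by (simp add: M_def)
  have Hhat_inner: "v i \<bullet> (Hhat *v y) = max (l i) lam * (v i \<bullet> y)" for i y
    unfolding Hhat_eq by (rule inner_eigenvector_spectral_sum[OF on])
  have descent: "p \<bullet> g \<le> - (norm g)\<^sup>2 / (2 * M)"
  proof (rule inexact_newton_direction[OF on Hhat_inner _ _ lam Hhat(2) iter(4)])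
    show "max (l i) lam \<le> M" for i
      using l_le[of i] by (auto simp: M_def)
    show "\<theta>\<^sub>1 \<le> 1 / 2 * sqrt (lam / M)"
      using assms(13) by (simp add: M_def max.commute)
  qed simp
  have curvature: "lam * (p \<bullet> p) \<le> p \<bullet> (Hhat *v p)"
  proof -
    have "lam * (p \<bullet> p) = (\<Sum>i\<in>UNIV. lam * ((v i \<bullet> p) * (v i \<bullet> p)))"
      unfolding inner_orthonormal_expansion[OF on, of p p] by (simp add: sum_distrib_left)
    also have "\<dots> \<le> (\<Sum>i\<in>UNIV. max (l i) lam * ((v i \<bullet> p) * (v i \<bullet> p)))"
      by (intro sum_mono mult_right_mono) auto
    also have "\<dots> = p \<bullet> (Hhat *v p)"
      unfolding inner_orthonormal_expansion[OF on, of p "Hhat *v p"]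
      by (simp add: Hhat_inner mult_ac)
    finally show ?thesis .
  qed
  \<comment> \<open>The second argument is the step at which the curvature term
    \<open>K * a / 2 * (p \<bullet> p)\<close> is still covered by the slack
    \<open>(1 - \<beta>) * (- (p \<bullet> g))\<close>; the minimum makes \<open>a\<close>
    admissible for the line search.\<close>
  define a where "a = min \<alpha>hat (2 * (1 - \<theta>\<^sub>2) * (1 - \<beta>) * lam / K)"
  have "0 < a"
    using assms lam by (simp add: a_def)
  have "armijo F \<beta> x p a"
  proof -
    have "a \<le> 2 * ((1 - \<theta>\<^sub>2) * (1 - \<beta>) * lam) / K"
      unfolding a_def by (simp only: mult.assoc min.cobounded2)
    then have "K * a / 2 \<le> (1 - \<theta>\<^sub>2) * (1 - \<beta>) * lam"
      using \<open>0 < K\<close> by (simp add: pos_le_divide_eq mult.commute)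
    then have "K * a / 2 * (p \<bullet> p) \<le> (1 - \<theta>\<^sub>2) * (1 - \<beta>) * lam * (p \<bullet> p)"
      by (intro mult_right_mono) auto
    also have "\<dots> = (1 - \<beta>) * ((1 - \<theta>\<^sub>2) * (lam * (p \<bullet> p)))"
      by simp
    also have "\<dots> \<le> (1 - \<beta>) * ((1 - \<theta>\<^sub>2) * (p \<bullet> (Hhat *v p)))"
      using assms curvature by (intro mult_left_mono) auto
    also have "\<dots> \<le> (1 - \<beta>) * (- (p \<bullet> g))"
      using Hhat(3) \<open>\<beta> < 1\<close> by (intro mult_left_mono) (auto simp: algebra_simps)
    finally have "a * (p \<bullet> g + K * a / 2 * (p \<bullet> p)) \<le> a * (\<beta> * (p \<bullet> g))"
      using \<open>0 < a\<close> by (intro mult_left_mono) (auto simp: algebra_simps)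
    then show ?thesis
      using upper_quadratic_bound[OF td assms(6), of x "a *\<^sub>R p"]
      by (simp add: armijo_def g_def algebra_simps)
  qed
  \<comment> \<open>Maximality of \<open>\<alpha>\<close> among admissible steps. It also settles
    the sign of \<open>\<alpha>\<close>, which the line search itself does not prescribe and which
    scaling the descent bound requires.\<close>
  then have "a \<le> \<alpha>"
    using ls by (simp add: line_search_step_def a_def)
  with \<open>0 < a\<close> have "0 < \<alpha>"
    by simp
  have "F x' \<le> F x + \<alpha> * \<beta> * (p \<bullet> g)"
    using ls by (simp add: line_search_step_def armijo_def x' g_def)
  also have "\<alpha> * \<beta> * (p \<bullet> g) \<le> \<alpha> * \<beta> * (- (norm g)\<^sup>2 / (2 * M))"
    using descent \<open>0 < \<alpha>\<close> \<open>0 < \<beta>\<close> by (intro mult_left_mono) auto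
  finally have decrease: "F x' \<le> F x - \<alpha> * \<beta> / (2 * M) * (norm g)\<^sup>2"
    by simp
  have "F x' - F xstar \<le> (1 - \<alpha> * \<beta> * \<gamma> / M) * (F x - F xstar)"
    if "0 < \<gamma>" "\<forall>y. mat \<gamma> \<preceq>\<^sub>L hessian F y" for \<gamma> xstar
  proof -
    \<comment> \<open>Scaling this gap bound by the coefficient
      \<open>\<alpha> * \<beta> / (2 * M)\<close> of the decrease cancels the factor 2 and leaves
      the rate.\<close>
    have "2 * \<gamma> * (F x - F xstar) \<le> (norm g)\<^sup>2"
      unfolding g_def using that by (intro polyak_lojasiewicz[OF td]) auto
    then have "\<alpha> * \<beta> / (2 * M) * (2 * \<gamma> * (F x - F xstar)) \<le> \<alpha> * \<beta> / (2 * M) * (norm g)\<^sup>2"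
      using \<open>0 < \<alpha>\<close> \<open>0 < \<beta>\<close> M by (intro mult_left_mono) auto
    moreover have "\<alpha> * \<beta> / (2 * M) * (2 * \<gamma> * (F x - F xstar)) = \<alpha> * \<beta> * \<gamma> / M * (F x - F xstar)"
      by simp
    ultimately show ?thesis
      using decrease by (simp only: left_diff_distrib mult_1)
  qed
  with decrease \<open>a \<le> \<alpha>\<close> show ?thesis
    by (auto simp: M_def g_def a_def)
qed

end
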